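(* Let $G=(V,E)$ be a finite graph with at least one vertex and $k>0$ an integer. Let $\mathcal F^{(2)}_k$ be the set of all stars $\sigma=\{(A_1,B_1),(A_2,B_2)\}\subseteq\vec S_k$ (with possibly $(A_1,B_1)=(A_2,B_2)$) such that $|B_1\cap B_2|<k$. The following are equivalent: (i) $G$ has a blockage of order $k-1$; (ii) $G$ has an $\mathcal F^{(2)}_k$-tangle of $S_k$; (iii) $G$ has no $S_k$-tree over $\mathcal F^{(2)}_k$; (iv) $G$ has path-width at least $k-1$.
   Context: An oriented vertex separation of $G$ is an ordered pair $(A,B)$ with $A\cup B=V$ and no edge between $A\setminus B$ and $B\setminus A$; $(A,B)\le(C,D)$ iff $A\subseteq C$ and $B\supseteq D$; $(A,B)^*=(B,A)$. $\vec S_k$ is the set of those with $|A\cap B|<k$, and $S_k$ the set of pairs $\{(A,B),(B,A)\}$ with $(A,B)\in\vec S_k$ (identified with unordered pairs $\{A,B\}$). A star is a nonempty set $\sigma$ with $\vec r\le\vec s^{\,*}$ for all distinct $\vec r,\vec s\in\sigma$. An orientation of $S_k$ contains exactly one of $(A,B),(B,A)$ for each pair; it is consistent if there are no distinct $r,s\in S_k$ with orientations $\vec r<\vec s$ such that $\vec r^{\,*},\vec s\in O$; an $\mathcal F$-tangle is a consistent orientation of $S_k$ no subset of which lies in $\mathcal F$. An $S_k$-tree over $\mathcal F$ is a pair $(T,\alpha)$, $T$ a finite tree with at least one edge, $\alpha$ mapping each ordered pair $(x,y)$ with $xy\in E(T)$ to $\vec S_k$ with $\alpha(y,x)=\alpha(x,y)^*$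 and $\{\alpha(x,t):xt\in E(T)\}\in\mathcal F$ for every node $t$. For $X\subseteq V$, $\partial(X)$ is the set of vertices of $X$ with a neighbour outside $X$. A blockage of order $k-1$ is a collection $\mathcal B$ of subsets of $V$ such that (B1) $|\partial(X)|<k$ for all $X\in\mathcal B$; (B2) $X'\in\mathcal B$ whenever $X'\subseteq X\in\mathcal B$ and $|\partial(X')|<k$; (B3) for every $\{X_1,X_2\}\in S_k$, exactly one of $X_1,X_2$ lies in $\mathcal B$. Path-width is the minimum width of a tree-decomposition whose tree is a path. *)

theory Defs
  imports Main
begin

definition finite_graph :: "'v set \<Rightarrow> ('v \<Rightarrow> 'v \<Rightarrow> bool) \<Rightarrow> bool" where
  "finite_graph V E \<longleftrightarrow> finite V \<and>
     (\<forall>x y. E x y \<longrightarrow> x \<in> V \<and> y \<in> V \<and> x \<noteq> y \<and> E y x)"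

definition is_sep :: "'v set \<Rightarrow> ('v \<Rightarrow> 'v \<Rightarrow> bool) \<Rightarrow> 'v set \<times> 'v set \<Rightarrow> bool" where
  "is_sep V E s \<longleftrightarrow> (case s of (A, B) \<Rightarrow>
     A \<union> B = V \<and> (\<forall>a \<in> A - B. \<forall>b \<in> B - A. \<not> E a b))"

definition sep_le :: "'v set \<times> 'v set \<Rightarrow> 'v set \<times> 'v set \<Rightarrow> bool" where
  "sep_le s t \<longleftrightarrow> fst s \<subseteq> fst t \<and> snd t \<subseteq> snd s"

definition sep_inv :: "'v set \<times> 'v set \<Rightarrow> 'v set \<times> 'v set" where
  "sep_inv s = (snd s, fst s)"

definition vS :: "'v set \<Rightarrow> ('v \<Rightarrow> 'v \<Rightarrow> bool) \<Rightarrow> nat \<Rightarrow> ('v set \<times> 'v set) set" where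
  "vS V E k = {s. is_sep V E s \<and> card (fst s \<inter> snd s) < k}"

definition is_star :: "('v set \<times> 'v set) set \<Rightarrow> bool" where
  "is_star \<sigma> \<longleftrightarrow> \<sigma> \<noteq> {} \<and> (\<forall>r \<in> \<sigma>. \<forall>s \<in> \<sigma>. r \<noteq> s \<longrightarrow> sep_le r (sep_inv s))"

definition F2 :: "'v set \<Rightarrow> ('v \<Rightarrow> 'v \<Rightarrow> bool) \<Rightarrow> nat \<Rightarrow> ('v set \<times> 'v set) set set" where
  "F2 V E k = {\<sigma>. \<exists>A1 B1 A2 B2. \<sigma> = {(A1, B1), (A2, B2)} \<and> \<sigma> \<subseteq> vS V E k \<and>
                   is_star \<sigma> \<and> card (B1 \<inter> B2) < k}"

definition is_orientation :: "'v set \<Rightarrow> ('v \<Rightarrow> 'v \<Rightarrow> bool) \<Rightarrow> nat \<Rightarrow> ('v set \<times> 'v set) set \<Rightarrow> bool" where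
  "is_orientation V E k Or \<longleftrightarrow> Or \<subseteq> vS V E k \<and>
     (\<forall>s \<in> vS V E k. (s \<in> Or \<or> sep_inv s \<in> Or) \<and>
                     (s \<in> Or \<and> sep_inv s \<in> Or \<longrightarrow> s = sep_inv s))"

definition consistent :: "'v set \<Rightarrow> ('v \<Rightarrow> 'v \<Rightarrow> bool) \<Rightarrow> nat \<Rightarrow> ('v set \<times> 'v set) set \<Rightarrow> bool" where
  "consistent V E k Or \<longleftrightarrow>
     \<not> (\<exists>r \<in> vS V E k. \<exists>s \<in> vS V E k. s \<noteq> r \<and> s \<noteq> sep_inv r \<and>
            sep_le r s \<and> sep_inv r \<in> Or \<and> s \<in> Or)"

definition is_F_tangle :: "'v set \<Rightarrow> ('v \<Rightarrow> 'v \<Rightarrow> bool) \<Rightarrow> nat \<Rightarrow> ('v set \<times> 'v set) set set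
      \<Rightarrow> ('v set \<times> 'v set) set \<Rightarrow> bool" where
  "is_F_tangle V E k F Or \<longleftrightarrow> is_orientation V E k Or \<and> consistent V E k Or \<and>
     (\<forall>\<sigma>. \<sigma> \<subseteq> Or \<longrightarrow> \<sigma> \<notin> F)"

definition is_tree :: "nat set \<Rightarrow> (nat \<Rightarrow> nat \<Rightarrow> bool) \<Rightarrow> bool" where
  "is_tree N TE \<longleftrightarrow> finite N \<and> N \<noteq> {} \<and>
     (\<forall>x y. TE x y \<longrightarrow> x \<in> N \<and> y \<in> N \<and> x \<noteq> y \<and> TE y x) \<and>
     (\<forall>x \<in> N. \<forall>y \<in> N. TE\<^sup>*\<^sup>* x y) \<and>
     \<not> (\<exists>cs. length cs \<ge> 3 \<and> distinct cs \<and>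
             (\<forall>i < length cs - 1. TE (cs ! i) (cs ! Suc i)) \<and> TE (last cs) (hd cs))"

text \<open>An S_k-tree over F (trees with nodes labelled by natural numbers, which
  is no restriction since trees are finite).\<close>
definition is_Sk_tree :: "'v set \<Rightarrow> ('v \<Rightarrow> 'v \<Rightarrow> bool) \<Rightarrow> nat \<Rightarrow> ('v set \<times> 'v set) set set
      \<Rightarrow> nat set \<Rightarrow> (nat \<Rightarrow> nat \<Rightarrow> bool) \<Rightarrow> (nat \<times> nat \<Rightarrow> 'v set \<times> 'v set) \<Rightarrow> bool" where
  "is_Sk_tree V E k F N TE \<alpha> \<longleftrightarrow> is_tree N TE \<and> (\<exists>x y. TE x y) \<and>
     (\<forall>x y. TE x y \<longrightarrow> \<alpha> (x, y) \<in> vS V E k \<and> \<alpha> (y, x) = sep_inv (\<alpha> (x, y))) \<and>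
     (\<forall>t \<in> N. {\<alpha> (x, t) | x. TE x t} \<in> F)"

definition bdry :: "'v set \<Rightarrow> ('v \<Rightarrow> 'v \<Rightarrow> bool) \<Rightarrow> 'v set \<Rightarrow> 'v set" where
  "bdry V E X = {x \<in> X. \<exists>y \<in> V - X. E x y}"

definition is_blockage :: "'v set \<Rightarrow> ('v \<Rightarrow> 'v \<Rightarrow> bool) \<Rightarrow> nat \<Rightarrow> 'v set set \<Rightarrow> bool" where
  "is_blockage V E k \<B> \<longleftrightarrow> (\<forall>X \<in> \<B>. X \<subseteq> V) \<and>
     (\<forall>X \<in> \<B>. card (bdry V E X) < k) \<and>
     (\<forall>X \<in> \<B>. \<forall>X'. X' \<subseteq> X \<and> card (bdry V E X') < k \<longrightarrow> X' \<in> \<B>) \<and>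
     (\<forall>X1 X2. (X1, X2) \<in> vS V E k \<longrightarrow> ((X1 \<in> \<B>) \<noteq> (X2 \<in> \<B>)))"

definition is_path_decomp :: "'v set \<Rightarrow> ('v \<Rightarrow> 'v \<Rightarrow> bool) \<Rightarrow> 'v set list \<Rightarrow> bool" where
  "is_path_decomp V E bs \<longleftrightarrow> bs \<noteq> [] \<and> (\<forall>X \<in> set bs. X \<subseteq> V) \<and>
     (\<forall>v \<in> V. \<exists>X \<in> set bs. v \<in> X) \<and>
     (\<forall>u v. E u v \<longrightarrow> (\<exists>X \<in> set bs. u \<in> X \<and> v \<in> X)) \<and>
     (\<forall>i j l. i \<le> j \<and> j \<le> l \<and> l < length bs \<longrightarrow> bs ! i \<inter> bs ! l \<subseteq> bs ! j)"

definition decomp_width :: "'v set list \<Rightarrow> nat" where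
  "decomp_width bs = Max (card ` set bs) - 1"

definition pathwidth :: "'v set \<Rightarrow> ('v \<Rightarrow> 'v \<Rightarrow> bool) \<Rightarrow> nat" where
  "pathwidth V E = (LEAST w. \<exists>bs. is_path_decomp V E bs \<and> decomp_width bs = w)"

end

theory Submission
  imports Defs
begin

text \<open>
  The heart of the matter is that large path-width yields a blockage.  Consider chains
  \<open>s\<^sub>0 \<le> s\<^sub>1 \<le> \<dots> \<le> s\<^sub>n\<close> of separations such that the mixed pairs
  \<open>(fst s\<^bsub>i+1\<^esub>, snd s\<^sub>i)\<close> also have order less than \<open>k\<close>; a chain from a set in \<open>\<B>\<close> to a set
  in \<open>\<B>\<close> is one with \<open>fst s\<^sub>0 \<in> \<B>\<close> and \<open>snd s\<^sub>n \<in> \<B>\<close>.  If no path-decomposition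
  has all its bags of size less than \<open>k\<close>, then no chain joins two sets of size less than \<open>k\<close>.  Take a
  maximal family \<open>\<B>\<close> of sets of small boundary that contains all sets of size less than \<open>k\<close>, is closed
  under taking subsets of small boundary, and is not joined to itself by a chain.  If neither side
  of some separation lies in \<open>\<B>\<close>, choose minimal sets \<open>A\<close> and \<open>C\<close> outside \<open>\<B>\<close>, one in each
  side.  By maximality there are chains from \<open>A\<close> to \<open>\<B>\<close> and from \<open>C\<close> to \<open>\<B>\<close>.  By submodularity
  both can be shifted to start in a separation of minimum order between \<open>A\<close> and \<open>C\<close>, where they
  fit together to a chain from \<open>\<B>\<close> to \<open>\<B>\<close>, a contradiction.
\<close>

section \<open>Separations and chains\<close>

lemma sep_inv_sep_inv [simp]: "sep_inv (sep_inv s) = s"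
  by (simp add: sep_inv_def)

lemma fst_sep_inv [simp]: "fst (sep_inv s) = snd s"
  and snd_sep_inv [simp]: "snd (sep_inv s) = fst s"
  by (simp_all add: sep_inv_def)

locale graph_order =
  fixes V :: "'v set" and E :: "'v \<Rightarrow> 'v \<Rightarrow> bool" and k :: nat
  assumes graph: "finite_graph V E"
begin

lemma finite_V: "finite V"
  using graph by (simp add: finite_graph_def)

lemma edgeD: "E x y \<Longrightarrow> x \<in> V \<and> y \<in> V \<and> E y x"
  using graph by (simp add: finite_graph_def)

lemma mem_vS:
  "(A, B) \<in> vS V E k \<longleftrightarrow>
     A \<union> B = V \<and> (\<forall>a \<in> A - B. \<forall>b \<in> B - A. \<not> E a b) \<and> card (A \<inter> B) < k"
  by (auto simp: vS_def is_sep_def)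

lemma vS_union: "s \<in> vS V E k \<Longrightarrow> fst s \<union> snd s = V"
  by (cases s) (auto simp: mem_vS)

lemma sep_inv_vS: "s \<in> vS V E k \<Longrightarrow> sep_inv s \<in> vS V E k"
  by (cases s) (auto simp: mem_vS sep_inv_def Int_commute dest: edgeD)

lemma bdry_vS:
  assumes "(A, B) \<in> vS V E k"
  shows "card (bdry V E A) < k"
proof -
  have "bdry V E A \<subseteq> A \<inter> B"
    using assms by (auto simp: mem_vS bdry_def dest: edgeD)
  moreover have "finite (A \<inter> B)"
    using assms finite_V by (auto simp: mem_vS intro: finite_subset)
  ultimately show ?thesis
    using assms by (meson card_mono le_less_trans mem_vS)
qed

lemma small_vS: "A \<subseteq> V \<Longrightarrow> card A < k \<Longrightarrow> (A, V) \<in> vS V E k"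
  by (auto simp: mem_vS Int_absorb2)

text \<open>The separator \<open>fst t \<inter> snd s\<close> of the mixed pair is the bag that a
  step contributes to a path-decomposition; the last condition bounds its size.\<close>

definition step :: "'v set \<times> 'v set \<Rightarrow> 'v set \<times> 'v set \<Rightarrow> bool" where
  "step s t \<longleftrightarrow> s \<in> vS V E k \<and> t \<in> vS V E k \<and> sep_le s t \<and> (fst t, snd s) \<in> vS V E k"

lemma step_inv: "step s t \<Longrightarrow> step (sep_inv t) (sep_inv s)"
  using sep_inv_vS[of "(fst t, snd s)"] sep_inv_vS[of s] sep_inv_vS[of t]
  by (simp add: step_def sep_le_def sep_inv_def)

lemma steps_inv: "step\<^sup>*\<^sup>* s t \<Longrightarrow> step\<^sup>*\<^sup>* (sep_inv t) (sep_inv s)"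
  by (induction rule: rtranclp_induct) (auto intro: step_inv converse_rtranclp_into_rtranclp)

lemma steps_le: "step\<^sup>*\<^sup>* s t \<Longrightarrow> sep_le s t"
  by (induction rule: rtranclp_induct) (auto simp: step_def sep_le_def)

lemma steps_vS: "step\<^sup>*\<^sup>* s t \<Longrightarrow> s \<in> vS V E k \<Longrightarrow> t \<in> vS V E k"
  by (induction rule: rtranclp_induct) (auto simp: step_def)

text \<open>A chain of length zero counts, so an unlinked family never contains both sides of one
  separation.\<close>

definition links :: "'v set set \<Rightarrow> bool" where
  "links \<B> \<longleftrightarrow> (\<exists>s t. s \<in> vS V E k \<and> step\<^sup>*\<^sup>* s t \<and> fst s \<in> \<B> \<and> snd t \<in> \<B>)"

section \<open>Shifting\<close>

text \<open>A minimum separation of \<open>A\<close> from \<open>C\<close>, as in Menger's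
  theorem.\<close>

definition tight :: "'v set \<Rightarrow> 'v set \<Rightarrow> 'v set \<Rightarrow> 'v set \<Rightarrow> bool" where
  "tight A C X Y \<longleftrightarrow> (X, Y) \<in> vS V E k \<and> A \<subseteq> X \<and> C \<subseteq> Y \<and>
     (\<forall>X' Y'. (X', Y') \<in> vS V E k \<and> A \<subseteq> X' \<and> C \<subseteq> Y' \<longrightarrow> card (X \<inter> Y) \<le> card (X' \<inter> Y'))"

lemma tight_exists:
  assumes "(A0, B0) \<in> vS V E k" "A \<subseteq> A0" "C \<subseteq> B0"
  obtains X Y where "tight A C X Y"
proof -
  let ?P = "\<lambda>s. s \<in> vS V E k \<and> A \<subseteq> fst s \<and> C \<subseteq> snd s"
  define m where "m = arg_min (\<lambda>s. card (fst s \<inter> snd s)) ?P"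
  have P: "?P (A0, B0)" using assms by simp
  have 1: "?P m"
    unfolding m_def by (rule arg_min_natI[of ?P, OF P])
  have 2: "card (fst m \<inter> snd m) \<le> card (fst s \<inter> snd s)" if "?P s" for s
    unfolding m_def by (rule arg_min_nat_le[of ?P, OF that])
  have "tight A C (fst m) (snd m)"
    unfolding tight_def
  proof (intro conjI allI impI)
    fix X' Y' assume "(X', Y') \<in> vS V E k \<and> A \<subseteq> X' \<and> C \<subseteq> Y'"
    then show "card (fst m \<inter> snd m) \<le> card (X' \<inter> Y')"
      using 2[of "(X', Y')"] by simp
  qed (use 1 in auto)
  then show thesis by (rule that)
qed

lemma tight_sym: "tight A C X Y \<Longrightarrow> tight C A Y X"
  unfolding tight_def
  by (metis Int_commute fst_conv sep_inv_def sep_inv_vS snd_conv)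

text \<open>Since \<open>(X \<inter> P, Y \<union> Q)\<close> also separates \<open>A\<close> from \<open>C\<close>, submodularity of the order bounds the
  order of the opposite corner by that of \<open>(P, Q)\<close>.\<close>

lemma shift_vS:
  assumes t: "tight A C X Y" and PQ: "(P, Q) \<in> vS V E k" and A: "A \<subseteq> P"
  shows "(X \<union> P, Y \<inter> Q) \<in> vS V E k"
proof -
  have XY: "(X, Y) \<in> vS V E k" and AX: "A \<subseteq> X" and CY: "C \<subseteq> Y"
    using t by (auto simp: tight_def)
  have fin: "finite X" "finite Y" "finite P" "finite Q"
    using XY PQ finite_V by (simp_all add: mem_vS) (metis finite_Un)+
  have "card ((X \<union> P) \<inter> (Y \<inter> Q)) + card ((X \<inter> P) \<inter> (Y \<union> Q)) \<le> card (X \<inter> Y) + card (P \<inter> Q)"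
  proof -
    \<comment> \<open>Submodularity, by counting the union and the intersection of the two corner
      separators.\<close>
    have "((X \<union> P) \<inter> (Y \<inter> Q)) \<union> ((X \<inter> P) \<inter> (Y \<union> Q)) \<subseteq> (X \<inter> Y) \<union> (P \<inter> Q)"
      and "((X \<union> P) \<inter> (Y \<inter> Q)) \<inter> ((X \<inter> P) \<inter> (Y \<union> Q)) \<subseteq> (X \<inter> Y) \<inter> (P \<inter> Q)"
      by blast+
    then have "card (((X \<union> P) \<inter> (Y \<inter> Q)) \<union> ((X \<inter> P) \<inter> (Y \<union> Q))) \<le> card ((X \<inter> Y) \<union> (P \<inter> Q))"
      and "card (((X \<union> P) \<inter> (Y \<inter> Q)) \<inter> ((X \<inter> P) \<inter> (Y \<union> Q))) \<le> card ((X \<inter> Y) \<inter> (P \<inter> Q))"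
      using fin by (simp_all add: card_mono)
    then show ?thesis
      using fin card_Un_Int[of "(X \<union> P) \<inter> (Y \<inter> Q)" "(X \<inter> P) \<inter> (Y \<union> Q)"]
        card_Un_Int[of "X \<inter> Y" "P \<inter> Q"] by simp
  qed
  moreover have "card (X \<inter> Y) \<le> card ((X \<inter> P) \<inter> (Y \<union> Q))"
  \<comment> \<open>Tightness speaks only about corners of order below \<open>k\<close>; a corner of
    larger order exceeds that of \<open>(X, Y)\<close> anyway.\<close>
  proof (cases "card ((X \<inter> P) \<inter> (Y \<union> Q)) < k")
    case True
    then have "(X \<inter> P, Y \<union> Q) \<in> vS V E k"
      using XY PQ by (simp add: mem_vS) blast
    moreover have "A \<subseteq> X \<inter> P" "C \<subseteq> Y \<union> Q"
      using A AX CY by auto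
    ultimately show ?thesis
      using t unfolding tight_def by blast
  next
    case False
    then show ?thesis using XY by (simp add: mem_vS)
  qed
  ultimately have "card ((X \<union> P) \<inter> (Y \<inter> Q)) < k"
    using PQ by (simp add: mem_vS)
  then show ?thesis
    using XY PQ by (simp add: mem_vS) blast
qed

text \<open>The mixed pair of two neighbours in the chain also has \<open>A\<close> inside its first
  side, so \<open>shift_vS\<close> bounds its shift too, and shifted steps are again steps.\<close>

lemma shift_steps:
  assumes t: "tight A C X Y" and st: "step\<^sup>*\<^sup>* s u" and s: "s \<in> vS V E k" "fst s = A"
  shows "step\<^sup>*\<^sup>* (X, Y) (X \<union> fst u, Y \<inter> snd u)"
  using st
proof (induction rule: rtranclp_induct)
  case base
  have "(X, Y) \<in> vS V E k" "A \<subseteq> X" using t by (auto simp: tight_def)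
  moreover have "(X \<union> fst s, Y \<inter> snd s) \<in> vS V E k"
    using shift_vS[OF t, of "fst s" "snd s"] s by (metis order_refl prod.collapse)
  \<comment> \<open>The mixed pair of this step is \<open>(X, Y)\<close> itself, since
    \<open>fst s = A\<close> lies in \<open>X\<close>.\<close>
  ultimately have "step (X, Y) (X \<union> fst s, Y \<inter> snd s)"
    using s by (auto simp: step_def sep_le_def sup_absorb1)
  then show ?case ..
next
  case (step u w)
  have "A \<subseteq> fst u" "A \<subseteq> fst w"
    using steps_le[OF step.hyps(1)] step.hyps(2) s by (auto simp: sep_le_def step_def)
  then have "(X \<union> fst u, Y \<inter> snd u) \<in> vS V E k" "(X \<union> fst w, Y \<inter> snd w) \<in> vS V E k"
    "(X \<union> fst w, Y \<inter> snd u) \<in> vS V E k"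
    using step.hyps(2) by (auto simp: step_def intro!: shift_vS[OF t])
  then have "step (X \<union> fst u, Y \<inter> snd u) (X \<union> fst w, Y \<inter> snd w)"
    using step.hyps(2) by (auto simp: step_def sep_le_def)
  with step.IH show ?case ..
qed

section \<open>Maximal unlinked families are blockages\<close>

text \<open>Here (B1) and (B2) are kept, while (B3) is replaced by unlinkedness and the presence of
  all small sets; maximality will restore (B3).\<close>

definition unlinked_family :: "'v set set \<Rightarrow> bool" where
  "unlinked_family \<B> \<longleftrightarrow> (\<forall>X \<in> \<B>. X \<subseteq> V \<and> card (bdry V E X) < k) \<and>
     (\<forall>X. X \<subseteq> V \<and> card X < k \<longrightarrow> X \<in> \<B>) \<and>
     (\<forall>X \<in> \<B>. \<forall>X'. X' \<subseteq> X \<and> card (bdry V E X') < k \<longrightarrow> X' \<in> \<B>) \<and> \<not> links \<B>"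

lemma unlinked_familyD:
  assumes "unlinked_family \<B>"
  shows "X \<in> \<B> \<Longrightarrow> X \<subseteq> V"
    and "X \<in> \<B> \<Longrightarrow> card (bdry V E X) < k"
    and "X \<subseteq> V \<Longrightarrow> card X < k \<Longrightarrow> X \<in> \<B>"
    and "X \<in> \<B> \<Longrightarrow> X' \<subseteq> X \<Longrightarrow> card (bdry V E X') < k \<Longrightarrow> X' \<in> \<B>"
    and "\<not> links \<B>"
proof -
  note U = assms[unfolded unlinked_family_def]
  show "X \<in> \<B> \<Longrightarrow> X \<subseteq> V" and "X \<in> \<B> \<Longrightarrow> card (bdry V E X) < k"
    using U[THEN conjunct1] by auto
  show "X \<subseteq> V \<Longrightarrow> card X < k \<Longrightarrow> X \<in> \<B>"
    using U[THEN conjunct2, THEN conjunct1] by auto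
  show "X \<in> \<B> \<Longrightarrow> X' \<subseteq> X \<Longrightarrow> card (bdry V E X') < k \<Longrightarrow> X' \<in> \<B>"
    using U[THEN conjunct2, THEN conjunct2, THEN conjunct1, rule_format, of X X'] by blast
  show "\<not> links \<B>"
    using U[THEN conjunct2, THEN conjunct2, THEN conjunct2] .
qed

lemma minimal_nonmember:
  assumes "A0 \<subseteq> V" "card (bdry V E A0) < k" "A0 \<notin> \<B>"
  obtains A where "A \<subseteq> A0" "card (bdry V E A) < k" "A \<notin> \<B>"
    "\<And>A'. A' \<subset> A \<Longrightarrow> card (bdry V E A') < k \<Longrightarrow> A' \<in> \<B>"
proof -
  let ?\<A> = "{A. A \<subseteq> A0 \<and> card (bdry V E A) < k \<and> A \<notin> \<B>}"
  have "finite ?\<A>"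
    using assms(1) finite_V by (auto intro: finite_subset[of _ "Pow V"])
  then obtain A where "A \<in> ?\<A>" "\<forall>A' \<in> ?\<A>. A' \<subseteq> A \<longrightarrow> A = A'"
    using finite_has_minimal[of ?\<A>] assms by blast
  then show thesis
    by (intro that[of A]) auto
qed

text \<open>By minimality of \<open>A\<close>, the family \<open>insert A \<B>\<close> is still
  closed under subsets of small boundary, so by maximality it must contain a link. This link uses
  \<open>A\<close> at exactly one end, and reversing it if necessary makes that end the
  start.\<close>

lemma chain_from_minimal:
  assumes U: "unlinked_family \<B>" and max: "\<And>\<B>'. unlinked_family \<B>' \<Longrightarrow> \<B> \<subseteq> \<B>' \<Longrightarrow> \<B>' = \<B>"
    and A: "A \<subseteq> V" "card (bdry V E A) < k" "A \<notin> \<B>"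
      "\<And>A'. A' \<subset> A \<Longrightarrow> card (bdry V E A') < k \<Longrightarrow> A' \<in> \<B>"
  obtains s t where "s \<in> vS V E k" "step\<^sup>*\<^sup>* s t" "fst s = A" "snd t \<in> \<B>"
proof -
  have "\<not> unlinked_family (insert A \<B>)"
    using max[of "insert A \<B>"] A(3) by blast
  moreover have "\<forall>X \<in> insert A \<B>. X \<subseteq> V \<and> card (bdry V E X) < k"
    "\<forall>X. X \<subseteq> V \<and> card X < k \<longrightarrow> X \<in> insert A \<B>"
    using unlinked_familyD(1-3)[OF U] A(1,2) by blast+
  moreover have "\<forall>X \<in> insert A \<B>. \<forall>X'. X' \<subseteq> X \<and> card (bdry V E X') < k \<longrightarrow> X' \<in> insert A \<B>"
  proof (intro ballI allI impI)
    fix X X' assume X: "X \<in> insert A \<B>" and X': "X' \<subseteq> X \<and> card (bdry V E X') < k"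
    show "X' \<in> insert A \<B>"
    proof (cases "X \<in> \<B>")
      case True
      then show ?thesis using unlinked_familyD(4)[OF U] X' by blast
    next
      case False
      then have "X' = A \<or> X' \<subset> A" using X X' by blast
      then show ?thesis using A(4) X' by blast
    qed
  qed
  ultimately have "links (insert A \<B>)"
    unfolding unlinked_family_def by argo
  then obtain s t where st: "s \<in> vS V E k" "step\<^sup>*\<^sup>* s t" "fst s \<in> insert A \<B>" "snd t \<in> insert A \<B>"
    by (auto simp: links_def)
  have t: "t \<in> vS V E k" using st steps_vS by blast
  have "\<not> (fst s \<in> \<B> \<and> snd t \<in> \<B>)"
    using unlinked_familyD(5)[OF U] st unfolding links_def by blast
  \<comment> \<open>With \<open>A\<close> at both ends, \<open>A\<close> would be the separator of
    \<open>t\<close>, hence small and already in \<open>\<B>\<close>.\<close>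
  moreover have "\<not> (fst s = A \<and> snd t = A)"
  proof
    assume *: "fst s = A \<and> snd t = A"
    then have "fst t \<inter> snd t = A"
      using steps_le[OF st(2)] by (auto simp: sep_le_def)
    then have "card A < k"
      using t by (simp add: vS_def)
    then show False
      using unlinked_familyD(3)[OF U] A(1,3) by blast
  qed
  ultimately consider "fst s = A" "snd t \<in> \<B>" | "fst s \<in> \<B>" "snd t = A"
    using st by auto
  then show thesis
  proof cases
    case 1
    then show thesis using that st by blast
  next
    case 2
    then show thesis
      using that[of "sep_inv t" "sep_inv s"] steps_inv[OF st(2)] sep_inv_vS[OF t] by simp
  qed
qed

lemma maximal_unlinked_blockage:
  assumes U: "unlinked_family \<B>" and max: "\<And>\<B>'. unlinked_family \<B>' \<Longrightarrow> \<B> \<subseteq> \<B>' \<Longrightarrow> \<B>' = \<B>"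
  shows "is_blockage V E k \<B>"
proof -
  have down: "X' \<in> \<B>" if "X \<in> \<B>" "X' \<subseteq> X" "card (bdry V E X') < k" for X X'
    using unlinked_familyD(4)[OF U] that by blast
  have nolink: False if "s \<in> vS V E k" "step\<^sup>*\<^sup>* s t" "fst s \<in> \<B>" "snd t \<in> \<B>" for s t
    using unlinked_familyD(5)[OF U] that unfolding links_def by blast
  have one: "A0 \<in> \<B> \<or> B0 \<in> \<B>" if AB: "(A0, B0) \<in> vS V E k" for A0 B0
  proof (rule ccontr)
    assume "\<not> (A0 \<in> \<B> \<or> B0 \<in> \<B>)"
    then have "A0 \<notin> \<B>" "B0 \<notin> \<B>" by auto
    have BA: "(B0, A0) \<in> vS V E k" using sep_inv_vS[OF AB] by (simp add: sep_inv_def)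
    have sub: "A0 \<subseteq> V" "B0 \<subseteq> V" using AB by (auto simp: mem_vS)
    obtain A where A: "A \<subseteq> A0" "card (bdry V E A) < k" "A \<notin> \<B>"
      "\<And>A'. A' \<subset> A \<Longrightarrow> card (bdry V E A') < k \<Longrightarrow> A' \<in> \<B>"
      using minimal_nonmember[OF sub(1) bdry_vS[OF AB] \<open>A0 \<notin> \<B>\<close>] by metis
    obtain C where C: "C \<subseteq> B0" "card (bdry V E C) < k" "C \<notin> \<B>"
      "\<And>A'. A' \<subset> C \<Longrightarrow> card (bdry V E A') < k \<Longrightarrow> A' \<in> \<B>"
      using minimal_nonmember[OF sub(2) bdry_vS[OF BA] \<open>B0 \<notin> \<B>\<close>] by metis
    \<comment> \<open>The pair \<open>(A0, B0)\<close> itself separates \<open>A\<close> from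
      \<open>C\<close>, so a minimum exists.\<close>
    obtain X Y where t: "tight A C X Y"
      using tight_exists[OF AB A(1) C(1)] .
    \<comment> \<open>Stated for arbitrary \<open>A\<close>, \<open>C\<close>, \<open>X\<close>,
      \<open>Y\<close> because it is used once from each side of the separation.\<close>
    have end_in: "\<exists>t'. step\<^sup>*\<^sup>* (X, Y) t' \<and> t' \<in> vS V E k \<and> snd t' \<in> \<B>"
      if t: "tight A C X Y" and A: "A \<subseteq> V" "card (bdry V E A) < k" "A \<notin> \<B>"
        "\<And>A'. A' \<subset> A \<Longrightarrow> card (bdry V E A') < k \<Longrightarrow> A' \<in> \<B>" for A C X Y
    proof -
      obtain s u where su: "s \<in> vS V E k" "step\<^sup>*\<^sup>* s u" "fst s = A" "snd u \<in> \<B>"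
        using chain_from_minimal[OF U max A] by metis
      let ?t = "(X \<union> fst u, Y \<inter> snd u)"
      have path: "step\<^sup>*\<^sup>* (X, Y) ?t" using shift_steps[OF t su(2,1,3)] .
      then have tv: "?t \<in> vS V E k" using t steps_vS by (auto simp: tight_def)
      \<comment> \<open>Shifting shrinks the end \<open>snd u\<close> to
        \<open>Y \<inter> snd u\<close>, again a side of a separation, so (B2) keeps it in
        \<open>\<B>\<close>.\<close>
      then have "card (bdry V E (Y \<inter> snd u)) < k"
        using sep_inv_vS[OF tv] bdry_vS by (simp add: sep_inv_def)
      then have "snd ?t \<in> \<B>" using down[OF su(4)] by simp
      then show ?thesis using path tv by blast
    qed
    obtain t1 where t1: "step\<^sup>*\<^sup>* (X, Y) t1" "snd t1 \<in> \<B>"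
      using end_in[OF t _ A(2-4)] A(1) sub by blast
    obtain t2 where t2: "step\<^sup>*\<^sup>* (Y, X) t2" "t2 \<in> vS V E k" "snd t2 \<in> \<B>"
      using end_in[OF tight_sym[OF t] _ C(2-4)] C(1) sub by blast
    \<comment> \<open>Reversed, the chain for \<open>C\<close> ends at \<open>(X, Y)\<close>, where
      the chain for \<open>A\<close> starts; together they link \<open>\<B>\<close> to
      itself.\<close>
    have "step\<^sup>*\<^sup>* (sep_inv t2) (X, Y)"
      using steps_inv[OF t2(1)] by (simp add: sep_inv_def)
    then have "step\<^sup>*\<^sup>* (sep_inv t2) t1" using t1(1) by simp
    then show False
      using nolink[OF sep_inv_vS[OF t2(2)]] t1(2) t2(3) by simp
  qed
  have "\<not> (A0 \<in> \<B> \<and> B0 \<in> \<B>)" if "(A0, B0) \<in> vS V E k" for A0 B0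
    using nolink[OF that, of "(A0, B0)"] by auto
  with one show ?thesis
    using unlinked_familyD(1,2)[OF U] down unfolding is_blockage_def by (intro conjI; blast)
qed

section \<open>Chains and path-decompositions\<close>

lemma empty_vS: "k > 0 \<Longrightarrow> ({}, V) \<in> vS V E k" "k > 0 \<Longrightarrow> (V, {}) \<in> vS V E k"
  by (simp_all add: mem_vS)

text \<open>The bags are \<open>fst s\<close> followed by the separators of the mixed pairs. The
  last conjunct drives the induction: whatever a new bag shares with the part decomposed so far
  already lies in the last bag.\<close>

lemma chain_decomposition:
  assumes "step\<^sup>*\<^sup>* s t" "s \<in> vS V E k" "card (fst s) < k"
  shows "\<exists>bs. bs \<noteq> [] \<and> (\<forall>X \<in> set bs. card X < k) \<and> \<Union> (set bs) = fst t \<and>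
     (\<forall>u v. E u v \<and> u \<in> fst t \<and> v \<in> fst t \<longrightarrow> (\<exists>X \<in> set bs. u \<in> X \<and> v \<in> X)) \<and>
     (\<forall>i j l. i \<le> j \<and> j \<le> l \<and> l < length bs \<longrightarrow> bs ! i \<inter> bs ! l \<subseteq> bs ! j) \<and>
     fst t \<inter> snd t \<subseteq> last bs"
    (is "\<exists>bs. ?Q bs t")
  using assms(1)
proof (induction rule: rtranclp_induct)
  case base
  show ?case
    by (rule exI[of _ "[fst s]"]) (use assms in auto)
next
  case (step t u)
  from step.IH obtain bs where Q: "?Q bs t" by (elim exE)
  note bs = Q[THEN conjunct1]
    Q[THEN conjunct2, THEN conjunct1]
    Q[THEN conjunct2, THEN conjunct2, THEN conjunct1]
    Q[THEN conjunct2, THEN conjunct2, THEN conjunct2, THEN conjunct1]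
    Q[THEN conjunct2, THEN conjunct2, THEN conjunct2, THEN conjunct2, THEN conjunct1]
    Q[THEN conjunct2, THEN conjunct2, THEN conjunct2, THEN conjunct2, THEN conjunct2]
  obtain A B where t: "t = (A, B)" by (cases t)
  obtain C D where u: "u = (C, D)" by (cases u)
  have *: "A \<union> B = V" "\<forall>a \<in> A - B. \<forall>b \<in> B - A. \<not> E a b" "C \<subseteq> V" "A \<subseteq> C" "D \<subseteq> B" "card (C \<inter> B) < k"
    using step.hyps(2) by (auto simp: step_def t u mem_vS sep_le_def)
  let ?bs = "bs @ [B \<inter> C]"
  have interp: "?bs ! i \<inter> ?bs ! l \<subseteq> ?bs ! j" if ijl: "i \<le> j" "j \<le> l" "l < length ?bs" for i j l
  proof (cases "l < length bs")
    case True
    then show ?thesis using bs(5)[rule_format, of i j l] ijl by (simp add: nth_append)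
  next
    case False
    then have l: "l = length bs" using ijl by simp
    show ?thesis
    proof (cases "j = l")
      case True
      then show ?thesis by blast
    next
      case False
      then have j: "j < length bs" using ijl l by simp
      then have "bs ! i \<subseteq> A"
        using bs(3) ijl by (auto simp: t)
      \<comment> \<open>A vertex of the new bag and of an old one lies in
        \<open>A \<inter> B\<close>, hence in the last old bag, and interpolation among the old bags
        applies.\<close>
      then have "?bs ! i \<inter> ?bs ! l \<subseteq> bs ! i \<inter> (A \<inter> B)"
        using l j ijl by (auto simp: nth_append)
      also have "\<dots> \<subseteq> bs ! i \<inter> bs ! (length bs - 1)"
        using bs(1,6) by (auto simp: t last_conv_nth)
      also have "\<dots> \<subseteq> bs ! j"
        by (rule bs(5)[rule_format]) (use j ijl in linarith)
      finally show ?thesis using j by (simp add: nth_append)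
    qed
  qed
  have edges: "\<exists>X \<in> set ?bs. x \<in> X \<and> y \<in> X" if xy: "E x y" "x \<in> C" "y \<in> C" for x y
  proof (cases "x \<in> A \<and> y \<in> A")
    case True
    then show ?thesis using bs(4)[rule_format, of x y] xy by (auto simp: t)
  next
    case False
    \<comment> \<open>An edge with an end outside \<open>A\<close> cannot reach
      \<open>A - B\<close>, so both its ends are in \<open>B\<close>.\<close>
    then have "x \<in> B \<and> y \<in> B"
      using * xy edgeD[OF xy(1)] by blast
    then show ?thesis using xy by simp
  qed
  have "?Q ?bs u"
  proof (intro conjI)
    show "\<forall>X \<in> set ?bs. card X < k" using bs(2) * by (simp add: Int_commute)
    show "\<Union> (set ?bs) = fst u" using bs(3) * by (auto simp: t u)
    show "\<forall>x y. E x y \<and> x \<in> fst u \<and> y \<in> fst u \<longrightarrow> (\<exists>X \<in> set ?bs. x \<in> X \<and> y \<in> X)"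
      using edges by (simp add: u)
    show "\<forall>i j l. i \<le> j \<and> j \<le> l \<and> l < length ?bs \<longrightarrow> ?bs ! i \<inter> ?bs ! l \<subseteq> ?bs ! j"
      using interp by blast
    show "fst u \<inter> snd u \<subseteq> last ?bs" using * by (auto simp: u)
  qed simp
  then show ?case by (rule exI)
qed

text \<open>A link between small sets extends to a chain ending in \<open>(V, {})\<close>, which
  yields a path-decomposition of the whole graph into small bags.\<close>

lemma unlinked_small:
  assumes k: "k > 0" and no: "\<not> (\<exists>bs. is_path_decomp V E bs \<and> (\<forall>X \<in> set bs. card X < k))"
  shows "unlinked_family {X. X \<subseteq> V \<and> card X < k}"
proof -
  have fin: "finite X" if "X \<subseteq> V" for X using that finite_V by (rule finite_subset)
  have "\<not> links {X. X \<subseteq> V \<and> card X < k}"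
  proof
    assume "links {X. X \<subseteq> V \<and> card X < k}"
    then obtain s t where st: "s \<in> vS V E k" "step\<^sup>*\<^sup>* s t" "card (fst s) < k"
      "snd t \<subseteq> V" "card (snd t) < k"
      by (auto simp: links_def)
    have t: "t \<in> vS V E k" using st steps_vS by blast
    \<comment> \<open>The mixed pair is \<open>(V, snd t)\<close>, of order
      \<open>card (snd t)\<close>.\<close>
    have "step t (V, {})"
      using t st sep_inv_vS[OF small_vS[OF st(4,5)]] empty_vS[OF k] vS_union[OF t]
      by (auto simp: step_def sep_le_def sep_inv_def)
    with st have "step\<^sup>*\<^sup>* s (V, {})" by simp
    from chain_decomposition[OF this st(1,3)] obtain bs where bs: "bs \<noteq> []"
      "\<forall>X \<in> set bs. card X < k" "\<Union> (set bs) = V"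
      "\<And>u v. E u v \<Longrightarrow> u \<in> V \<Longrightarrow> v \<in> V \<Longrightarrow> \<exists>X \<in> set bs. u \<in> X \<and> v \<in> X"
      "\<forall>i j l. i \<le> j \<and> j \<le> l \<and> l < length bs \<longrightarrow> bs ! i \<inter> bs ! l \<subseteq> bs ! j"
      by auto
    have "is_path_decomp V E bs"
      unfolding is_path_decomp_def
    proof (intro conjI)
      show "\<forall>u v. E u v \<longrightarrow> (\<exists>X \<in> set bs. u \<in> X \<and> v \<in> X)" using bs(4) edgeD by blast
    qed (use bs in auto)
    with no bs(2) show False by blast
  qed
  moreover have "card (bdry V E X) < k" if "X \<subseteq> V" "card X < k" for X
    using bdry_vS[OF small_vS[OF that]] .
  moreover have "card X' < k" if "X' \<subseteq> X" "X \<subseteq> V" "card X < k" for X X'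
    using card_mono[OF fin that(1)] that by simp
  ultimately show ?thesis
    unfolding unlinked_family_def by auto
qed

lemma blockage_exists:
  assumes k: "k > 0" and no: "\<not> (\<exists>bs. is_path_decomp V E bs \<and> (\<forall>X \<in> set bs. card X < k))"
  shows "\<exists>\<B>. is_blockage V E k \<B>"
proof -
  have "finite (Collect unlinked_family)"
  proof (rule finite_subset)
    show "Collect unlinked_family \<subseteq> Pow (Pow V)"
      using unlinked_familyD(1) by blast
  qed (simp add: finite_V)
  moreover have "Collect unlinked_family \<noteq> {}"
    using unlinked_small[OF k no] by blast
  ultimately obtain \<B> where "\<B> \<in> Collect unlinked_family"
    "\<forall>\<B>' \<in> Collect unlinked_family. \<B> \<subseteq> \<B>' \<longrightarrow> \<B> = \<B>'"
    by (rule finite_has_maximal[THEN bexE])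
  then have "is_blockage V E k \<B>"
    by (intro maximal_unlinked_blockage) auto
  then show ?thesis ..
qed

section \<open>From blockages to tangles\<close>

lemma blockage_tangle:
  assumes "is_blockage V E k \<B>"
  shows "is_F_tangle V E k (F2 V E k) {s \<in> vS V E k. fst s \<in> \<B>}"
proof -
  have down: "X' \<in> \<B>" if "X \<in> \<B>" "X' \<subseteq> X" "card (bdry V E X') < k" for X X'
    using assms that unfolding is_blockage_def by blast
  have one: "(fst s \<in> \<B>) \<noteq> (snd s \<in> \<B>)" if "s \<in> vS V E k" for s
    using assms that unfolding is_blockage_def by (metis prod.collapse)
  have bd: "card (bdry V E (fst s)) < k" if "s \<in> vS V E k" for s
    using bdry_vS[of "fst s" "snd s"] that by simp
  \<comment> \<open>Members of \<open>\<B>\<close> are the small sides; each separation is oriented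
    with its small side first.\<close>
  let ?O = "{s \<in> vS V E k. fst s \<in> \<B>}"
  have "is_orientation V E k ?O"
    unfolding is_orientation_def using one sep_inv_vS by auto
  moreover have "consistent V E k ?O"
    unfolding consistent_def
  proof clarsimp
    fix A B C D assume "(A, B) \<in> vS V E k" "sep_le (A, B) (C, D)" "C \<in> \<B>" "B \<in> \<B>"
    \<comment> \<open>(B2) puts \<open>A\<close> into \<open>\<B>\<close> along with
      \<open>C\<close>, but (B3) forbids \<open>A\<close> and \<open>B\<close> together.\<close>
    then show False
      using down[of C A] one[of "(A, B)"] bd[of "(A, B)"] by (auto simp: sep_le_def)
  qed
  moreover have False if \<sigma>: "\<sigma> \<subseteq> ?O" "\<sigma> \<in> F2 V E k" for \<sigma>
  proof -
    obtain A1 B1 A2 B2 where *: "\<sigma> = {(A1, B1), (A2, B2)}" "is_star \<sigma>" "card (B1 \<inter> B2) < k"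
      using \<sigma>(2) by (auto simp: F2_def)
    have 1: "(A1, B1) \<in> vS V E k" "A1 \<in> \<B>" "(A2, B2) \<in> vS V E k" "A2 \<in> \<B>"
      using \<sigma>(1) * by auto
    then have B: "B1 \<notin> \<B>" "B2 \<notin> \<B>"
      using one[of "(A1, B1)"] one[of "(A2, B2)"] by auto
    show False
    proof (cases "(A1, B1) = (A2, B2)")
      case True
      \<comment> \<open>A one-element star bounds \<open>card B1\<close>. As \<open>B1\<close> is
        not in \<open>\<B>\<close>, (B3) puts \<open>V\<close> there, and then (B2) forces
        \<open>B1\<close> in after all.\<close>
      then have "(B1, V) \<in> vS V E k"
        using 1 * by (intro small_vS) (auto simp: mem_vS)
      then have "V \<in> \<B>" "card (bdry V E B1) < k" "B1 \<subseteq> V"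
        using one[of "(B1, V)"] bd[of "(B1, V)"] B by (auto simp: mem_vS)
      then show False using down B by blast
    next
      case False
      then have "A1 \<subseteq> B2" "A2 \<subseteq> B1"
        using * by (auto simp: is_star_def sep_le_def sep_inv_def)
      \<comment> \<open>The star inequalities make the two large sides a separation with neither
        side in \<open>\<B>\<close>, against (B3).\<close>
      then have "(B1, B2) \<in> vS V E k"
        using 1 * by (simp add: mem_vS) blast
      then show False using one[of "(B1, B2)"] B by simp
    qed
  qed
  ultimately show ?thesis
    unfolding is_F_tangle_def by blast
qed

end

section \<open>Trees\<close>

text \<open>Take the least positive return time \<open>d\<close> over all points of
  \<open>N\<close>. An earlier repetition on the orbit would give some point a shorter return, so
  the \<open>d\<close> iterates are distinct; the conditions on \<open>f\<close> exclude
  \<open>d = 1\<close> and \<open>d = 2\<close>.\<close>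

lemma functional_cycle:
  fixes f :: "'a \<Rightarrow> 'a"
  assumes fin: "finite N" "N \<noteq> {}"
    and f: "\<And>x. x \<in> N \<Longrightarrow> f x \<in> N \<and> TE x (f x) \<and> f x \<noteq> x \<and> f (f x) \<noteq> x"
  shows "\<exists>cs. length cs \<ge> 3 \<and> distinct cs \<and>
    (\<forall>i < length cs - 1. TE (cs ! i) (cs ! Suc i)) \<and> TE (last cs) (hd cs)"
proof -
  have N: "(f ^^ i) x \<in> N" if "x \<in> N" for i x
    using that f by (induction i) auto
  let ?P = "\<lambda>d. d > 0 \<and> (\<exists>x \<in> N. (f ^^ d) x = x)"
  have return: "?P (j - i)" if x: "x \<in> N" and "i < j" "(f ^^ i) x = (f ^^ j) x" for x i j
  proof -
    have "(f ^^ (j - i)) ((f ^^ i) x) = (f ^^ i) x"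
      using that by (metis comp_apply funpow_add le_add_diff_inverse2 less_imp_le)
    then show ?thesis using N[OF x] that by auto
  qed
  have "\<exists>d. ?P d"
  proof -
    obtain x where x: "x \<in> N" using fin by blast
    have "\<not> inj (\<lambda>i. (f ^^ i) x)"
    proof
      assume "inj (\<lambda>i. (f ^^ i) x)"
      moreover have "finite (range (\<lambda>i. (f ^^ i) x))"
        using N[OF x] fin by (auto intro: finite_subset[of _ N])
      ultimately show False
        by (metis finite_imageD infinite_UNIV_nat)
    qed
    then obtain i j where "i \<noteq> j" "(f ^^ i) x = (f ^^ j) x" by (auto simp: inj_def)
    then obtain i j where "i < j" "(f ^^ i) x = (f ^^ j) x" by (metis nat_neq_iff)
    then show ?thesis using return[OF x] by blast
  qed
  then obtain d where d: "?P d" "\<And>d'. d' < d \<Longrightarrow> \<not> ?P d'"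
    using exists_least_iff[of ?P] by blast
  then obtain x where x: "x \<in> N" "(f ^^ d) x = x" by blast
  let ?cs = "map (\<lambda>i. (f ^^ i) x) [0..<d]"
  have "d \<noteq> 1" using f[OF x(1)] x(2) by auto
  moreover have "d \<noteq> 2" using f[OF x(1)] x(2) by (auto simp: numeral_2_eq_2)
  ultimately have d3: "d \<ge> 3" using d(1) by linarith
  have "(f ^^ i) x \<noteq> (f ^^ j) x" if "i < j" "j < d" for i j
    using return[OF x(1) that(1)] d(2)[of "j - i"] that by auto
  then have "distinct ?cs"
    by (auto simp: distinct_map inj_on_def) (metis nat_neq_iff)
  moreover have edge: "TE ((f ^^ i) x) ((f ^^ Suc i) x)" for i
    using f[OF N[OF x(1)], of i] by simp
  then have "\<forall>i < length ?cs - 1. TE (?cs ! i) (?cs ! Suc i)"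
    by (auto simp: less_diff_conv simp del: funpow.simps)
  moreover have "TE (last ?cs) (hd ?cs)"
  proof -
    obtain m where m: "d = Suc m" using d3 by (cases d) auto
    then have "TE ((f ^^ m) x) x" using edge[of m] x(2) by simp
    then show ?thesis using d3 m by (simp add: last_map hd_map)
  qed
  ultimately show ?thesis using d3
    by (intro exI[of _ ?cs]) auto
qed

text \<open>An orientation of the tree edges has a sink, whose star lies in the tangle.\<close>

lemma tangle_no_tree:
  assumes tangle: "is_F_tangle V E k F Or"
  shows "\<not> is_Sk_tree V E k F N TE \<alpha>"
proof
  assume tree: "is_Sk_tree V E k F N TE \<alpha>"
  then have isT: "is_tree N TE"
    and \<alpha>: "\<And>x y. TE x y \<Longrightarrow> \<alpha> (x, y) \<in> vS V E k \<and> \<alpha> (y, x) = sep_inv (\<alpha> (x, y))"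
    and F: "\<And>t. t \<in> N \<Longrightarrow> {\<alpha> (x, t) | x. TE x t} \<in> F"
    by (auto simp: is_Sk_tree_def)
  have TE: "x \<in> N \<and> y \<in> N \<and> x \<noteq> y \<and> TE y x" if "TE x y" for x y
    using isT that unfolding is_tree_def by blast
  \<comment> \<open>A node without such a neighbour would be a sink, with its star in
    \<open>F\<close> and inside \<open>Or\<close>.\<close>
  have "\<exists>y. TE t y \<and> \<alpha> (y, t) \<notin> Or" if "t \<in> N" for t
  proof -
    have "\<not> {\<alpha> (x, t) | x. TE x t} \<subseteq> Or"
      using tangle F[OF that] by (auto simp: is_F_tangle_def)
    then show ?thesis using TE by blast
  qed
  then obtain f where f: "\<And>t. t \<in> N \<Longrightarrow> TE t (f t) \<and> \<alpha> (f t, t) \<notin> Or"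
    by metis
  have out: "\<alpha> (t, f t) \<in> Or" if "t \<in> N" for t
    using tangle \<alpha>[of t "f t"] f[OF that] unfolding is_F_tangle_def is_orientation_def by metis
  \<comment> \<open>Going straight back would put \<open>\<alpha> (f t, t)\<close> into
    \<open>Or\<close>, against the choice of \<open>f t\<close>.\<close>
  have "f (f t) \<noteq> t" if "t \<in> N" for t
    using out[of "f t"] f[OF that] TE[of t "f t"] by auto
  then have "\<exists>cs. length cs \<ge> 3 \<and> distinct cs \<and>
    (\<forall>i < length cs - 1. TE (cs ! i) (cs ! Suc i)) \<and> TE (last cs) (hd cs)"
    using isT f TE by (intro functional_cycle[of N f]) (auto simp: is_tree_def)
  then show False using isT unfolding is_tree_def by blast
qed

text \<open>On a cycle, both neighbours of the largest label would carry the label one below it.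
  With at least three nodes they sit at different positions \<open>?next i\<close> and
  \<open>p\<close>, so the cycle would repeat a node.\<close>

lemma path_is_tree:
  "is_tree {..n} (\<lambda>x y. x \<le> n \<and> y \<le> n \<and> (y = Suc x \<or> x = Suc y))" (is "is_tree _ ?TE")
proof -
  have up: "?TE\<^sup>*\<^sup>* 0 x" if "x \<le> n" for x
    using that by (induction x) (auto intro: rtranclp.rtrancl_into_rtrancl)
  have down: "?TE\<^sup>*\<^sup>* x 0" if "x \<le> n" for x
    using that
  proof (induction x)
    case (Suc x)
    then have "?TE (Suc x) x" "?TE\<^sup>*\<^sup>* x 0" by auto
    then show ?case by (rule converse_rtranclp_into_rtranclp)
  qed simp
  have conn: "?TE\<^sup>*\<^sup>* x y" if "x \<le> n" "y \<le> n" for x y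
    using down[OF that(1)] up[OF that(2)] by simp
  have acyclic: False
    if cs: "length cs \<ge> 3" "distinct cs"
      "\<forall>i < length cs - 1. ?TE (cs ! i) (cs ! Suc i)" "?TE (last cs) (hd cs)" for cs
  proof -
    let ?l = "length cs"
    let ?next = "\<lambda>i. if Suc i < ?l then Suc i else 0"
    have edge: "?TE (cs ! i) (cs ! ?next i)" if "i < ?l" for i
    proof (cases "Suc i < ?l")
      case True
      then have "i < ?l - 1" by simp
      then show ?thesis using cs(3) True by simp
    next
      case False
      then have i: "i = ?l - 1" and ne: "cs \<noteq> []" using that by auto
      show ?thesis using cs(4) False unfolding last_conv_nth[OF ne] hd_conv_nth[OF ne] i by simp
    qed
    have "Max (set cs) \<in> set cs" using cs(1) by (intro Max_in) auto
    then obtain i where i: "i < ?l" "cs ! i = Max (set cs)" by (auto simp: in_set_conv_nth)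
    have le: "cs ! j \<le> cs ! i" if "j < ?l" for j
      using that i(2) by simp
    define p where "p = (if i = 0 then ?l - 1 else i - 1)"
    have p: "p < ?l" "?next p = i" using cs(1) i(1) by (auto simp: p_def)
    have q: "?next i < ?l" "?next i \<noteq> p" using cs(1) i(1) by (auto simp: p_def)
    have "Suc (cs ! ?next i) = cs ! i" using edge[OF i(1)] le[OF q(1)] by auto
    moreover have "Suc (cs ! p) = cs ! i" using edge[OF p(1)] le[OF p(1)] unfolding p(2) by auto
    ultimately have "cs ! ?next i = cs ! p" by simp
    then show False using cs(2) p(1) q by (simp only: nth_eq_iff_index_eq)
  qed
  show ?thesis
    unfolding is_tree_def
    by (intro conjI) (use conn acyclic in \<open>auto simp del: One_nat_def\<close>)
qed

section \<open>From path-decompositions to trees\<close>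

context graph_order
begin

text \<open>The tree is the path whose node \<open>i\<close> stands for bag \<open>i\<close>. The
  edge from \<open>i\<close> to \<open>Suc i\<close> carries the union of the bags up to
  \<open>i\<close> against the union of those after it, so the star at a node has its bag as the
  intersection of the large sides.\<close>

lemma decomp_tree_ge2:
  assumes pd: "is_path_decomp V E bs" and card: "\<And>X. X \<in> set bs \<Longrightarrow> card X < k"
    and len: "length bs = Suc n" "n > 0"
  shows "\<exists>N TE \<alpha>. is_Sk_tree V E k (F2 V E k) N TE \<alpha>"
proof -
  define L where "L i = (\<Union>j \<in> {..i}. bs ! j)" for i
  define R where "R i = (\<Union>j \<in> {i..n}. bs ! j)" for i
  have bag: "card (bs ! i) < k" "bs ! i \<subseteq> V" if "i \<le> n" for i
    using that len pd card[of "bs ! i"] by (auto simp: is_path_decomp_def)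
  have cover: "\<exists>i \<le> n. v \<in> bs ! i" if "v \<in> V" for v
    using pd that len unfolding is_path_decomp_def by (metis in_set_conv_nth less_Suc_eq_le)
  have edge: "\<exists>i \<le> n. u \<in> bs ! i \<and> v \<in> bs ! i" if "E u v" for u v
    using pd that len unfolding is_path_decomp_def by (metis in_set_conv_nth less_Suc_eq_le)
  have interp: "bs ! i \<inter> bs ! l \<subseteq> bs ! j" if "i \<le> j" "j \<le> l" "l \<le> n" for i j l
    using pd that len unfolding is_path_decomp_def by simp
  have small: "card S < k" if "S \<subseteq> bs ! i" "i \<le> n" for S i
  proof -
    have "card S \<le> card (bs ! i)"
      using that bag(2)[OF that(2)] finite_V by (meson card_mono finite_subset)
    then show ?thesis using bag(1)[OF that(2)] by simp
  qed
  \<comment> \<open>Interpolation enters here: a vertex occurring both up to and from index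
    \<open>i\<close> on is in bag \<open>i\<close>.\<close>
  have LR: "L i \<inter> R i \<subseteq> bs ! i" for i
  proof
    fix v assume "v \<in> L i \<inter> R i"
    then obtain j l where "j \<le> i" "i \<le> l" "l \<le> n" "v \<in> bs ! j \<inter> bs ! l"
      by (auto simp: L_def R_def)
    then show "v \<in> bs ! i" using interp by blast
  qed
  have RS: "R (Suc i) \<subseteq> R i" for i
    unfolding R_def by (intro UN_mono) auto
  have LS: "L i \<subseteq> L (Suc i)" for i
    unfolding L_def by (intro UN_mono) auto
  have sep: "(L i, R (Suc i)) \<in> vS V E k" if "i < n" for i
  proof -
    have "card (L i \<inter> R (Suc i)) < k"
      using LR[of i] RS[of i] that by (intro small[of _ i]) auto
    moreover have "L i \<union> R (Suc i) = V"
    proof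
      show "L i \<union> R (Suc i) \<subseteq> V"
        unfolding L_def R_def by (intro Un_least UN_least bag(2)) (use that in auto)
      show "V \<subseteq> L i \<union> R (Suc i)"
      proof
        fix v assume "v \<in> V"
        then obtain j where "j \<le> n" "v \<in> bs ! j" using cover by blast
        then show "v \<in> L i \<union> R (Suc i)"
          by (cases "j \<le> i") (auto simp: L_def R_def not_less_eq_eq)
      qed
    qed
    moreover have "\<not> E a b" if "a \<in> L i - R (Suc i)" "b \<in> R (Suc i) - L i" for a b
    proof
      assume "E a b"
      then obtain j where "j \<le> n" "a \<in> bs ! j" "b \<in> bs ! j" using edge by blast
      \<comment> \<open>The bag containing the edge belongs entirely to \<open>L i\<close> or to
        \<open>R (Suc i)\<close>.\<close>
      then show False using that by (cases "j \<le> i") (auto simp: L_def R_def not_less_eq_eq)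
    qed
    ultimately show ?thesis by (auto simp: mem_vS)
  qed
  have sep': "(R (Suc i), L i) \<in> vS V E k" if "i < n" for i
    using sep_inv_vS[OF sep[OF that]] by (simp add: sep_inv_def)
  define TE where "TE = (\<lambda>x y. x \<le> n \<and> y \<le> n \<and> (y = Suc x \<or> x = Suc y))"
  define \<alpha> where "\<alpha> = (\<lambda>(x, y). if x < y then (L x, R y) else (R x, L y))"
  have star: "{\<alpha> (x, t) | x. TE x t} \<in> F2 V E k" if t: "t \<le> n" for t
  proof -
    have F2I: "{(A1, B1), (A2, B2)} \<in> F2 V E k"
      if "(A1, B1) \<in> vS V E k" "(A2, B2) \<in> vS V E k" "card (B1 \<inter> B2) < k"
        "(A1, B1) \<noteq> (A2, B2) \<Longrightarrow> A1 \<subseteq> B2 \<and> A2 \<subseteq> B1" for A1 B1 A2 B2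
      unfolding F2_def
    proof (intro CollectI exI conjI)
      show "is_star {(A1, B1), (A2, B2)}"
        using that(4) by (auto simp: is_star_def sep_le_def sep_inv_def)
    qed (use that in auto)
    consider "t = 0" | "t = n" "t > 0" | i where "t = Suc i" "Suc i < n"
    proof (cases t)
      case 0
      then show thesis by (rule that(1))
    next
      case (Suc i)
      then show thesis using t that(2) that(3)[of i] by (cases "t = n") auto
    qed
    then show ?thesis
    proof cases
      case 1
      \<comment> \<open>At a leaf the star is a single separation listed twice, so its whole large
        side, the end bag, has to be small.\<close>
      then have "{\<alpha> (x, t) | x. TE x t} = {(R (Suc 0), L 0), (R (Suc 0), L 0)}"
        using len by (auto simp: TE_def \<alpha>_def)
      moreover have "card (L 0 \<inter> L 0) < k"
        by (rule small[of _ 0]) (auto simp: L_def)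
      ultimately show ?thesis using sep'[of 0] len by (simp only:) (intro F2I; simp)
    next
      case 2
      then obtain m where m: "n = Suc m" by (cases n) auto
      have "{\<alpha> (x, t) | x. TE x t} = {(L m, R n), (L m, R n)}"
        using 2 m by (auto simp: TE_def \<alpha>_def)
      moreover have "card (R n \<inter> R n) < k"
        by (rule small[of _ n]) (auto simp: R_def)
      ultimately show ?thesis using sep[of m] m by (simp only:) (intro F2I; simp)
    next
      case 3
      have "{\<alpha> (x, t) | x. TE x t} = {(L i, R t), (R (Suc t), L t)}"
      proof -
        have "TE x t \<longleftrightarrow> x = i \<or> x = Suc t" for x
          using 3 by (auto simp: TE_def)
        then have "{\<alpha> (x, t) | x. TE x t} = {\<alpha> (i, t), \<alpha> (Suc t, t)}" by auto
        then show ?thesis using 3 by (simp add: \<alpha>_def)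
      qed
      moreover have "card (R t \<inter> L t) < k"
        by (rule small[of _ t]) (use LR[of t] 3 in auto)
      \<comment> \<open>The star inequalities are the monotonicity of \<open>L\<close> and
        \<open>R\<close>.\<close>
      ultimately show ?thesis
        using sep[of i] sep'[of t] 3 LS[of i] RS[of t] by (simp only:) (intro F2I; simp)
    qed
  qed
  have \<alpha>: "\<alpha> (x, y) \<in> vS V E k \<and> \<alpha> (y, x) = sep_inv (\<alpha> (x, y))" if "TE x y" for x y
    using that sep sep' by (auto simp: TE_def \<alpha>_def sep_inv_def)
  have "TE 0 (Suc 0)" using len by (simp add: TE_def)
  moreover have "is_tree {..n} TE" using path_is_tree[of n] by (simp only: TE_def)
  ultimately have "is_Sk_tree V E k (F2 V E k) {..n} TE \<alpha>"
    unfolding is_Sk_tree_def using \<alpha> star by auto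
  then show ?thesis by blast
qed

text \<open>A tree with an edge needs two bags, so an empty bag is added.\<close>

lemma decomp_tree:
  assumes pd: "is_path_decomp V E bs" and card: "\<And>X. X \<in> set bs \<Longrightarrow> card X < k" and k: "k > 0"
  shows "\<exists>N TE \<alpha>. is_Sk_tree V E k (F2 V E k) N TE \<alpha>"
proof (rule decomp_tree_ge2[of "bs @ [{}]" "length bs"])
  show "is_path_decomp V E (bs @ [{}])"
    using pd by (auto simp: is_path_decomp_def nth_append)
  show "length bs > 0" using pd by (auto simp: is_path_decomp_def)
qed (use card k in auto)

lemma pathwidth_less_iff:
  assumes "V \<noteq> {}"
  shows "pathwidth V E < k - 1 \<longleftrightarrow> (\<exists>bs. is_path_decomp V E bs \<and> (\<forall>X \<in> set bs. card X < k))"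
proof
  assume less: "pathwidth V E < k - 1"
  let ?P = "\<lambda>w. \<exists>bs. is_path_decomp V E bs \<and> decomp_width bs = w"
  \<comment> \<open>The one-bag decomposition ensures that the minimum defining
    \<open>pathwidth\<close> is attained.\<close>
  have "is_path_decomp V E [V]"
    using edgeD by (auto simp: is_path_decomp_def)
  then have "?P (decomp_width [V])" by blast
  then have "\<exists>bs. is_path_decomp V E bs \<and> decomp_width bs = pathwidth V E"
    unfolding pathwidth_def by (rule LeastI[of ?P])
  then obtain bs where bs: "is_path_decomp V E bs" "decomp_width bs = pathwidth V E"
    by blast
  then have "Max (card ` set bs) < k" using less by (simp add: decomp_width_def)
  then have "\<forall>X \<in> set bs. card X < k"
    using bs(1) by (auto simp: is_path_decomp_def)
  then show "\<exists>bs. is_path_decomp V E bs \<and> (\<forall>X \<in> set bs. card X < k)"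
    using bs by blast
next
  assume "\<exists>bs. is_path_decomp V E bs \<and> (\<forall>X \<in> set bs. card X < k)"
  then obtain bs where bs: "is_path_decomp V E bs" "\<forall>X \<in> set bs. card X < k" by blast
  have ne: "bs \<noteq> []" and sub: "\<forall>X \<in> set bs. X \<subseteq> V" and cover: "\<forall>v \<in> V. \<exists>X \<in> set bs. v \<in> X"
    using bs(1) by (simp_all add: is_path_decomp_def)
  obtain v where v: "v \<in> V" using assms by (meson ex_in_conv)
  obtain X where X: "v \<in> X" "X \<in> set bs" using bspec[OF cover v] by (elim bexE)
  \<comment> \<open>A nonempty bag makes the maximum positive, so subtracting one in the natural
    numbers does not truncate.\<close>
  have "card X > 0"
    using X finite_subset[OF bspec[OF sub X(2)] finite_V] by (auto simp: card_gt_0_iff)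
  moreover have "Max (card ` set bs) < k"
    using bs(2) ne by simp
  moreover have "card X \<le> Max (card ` set bs)"
    using \<open>X \<in> set bs\<close> by simp
  ultimately have "decomp_width bs < k - 1"
    by (simp add: decomp_width_def)
  moreover have "pathwidth V E \<le> decomp_width bs"
    unfolding pathwidth_def by (rule Least_le) (use bs(1) in blast)
  ultimately show "pathwidth V E < k - 1" by simp
qed

end

theorem theorem5p10:
  fixes V :: "'v set" and E :: "'v \<Rightarrow> 'v \<Rightarrow> bool" and k :: nat
  assumes "finite_graph V E" and "V \<noteq> {}" and "k > 0"
  shows "((\<exists>\<B>. is_blockage V E k \<B>) \<longleftrightarrow> (\<exists>Or. is_F_tangle V E k (F2 V E k) Or))
       \<and> ((\<exists>Or. is_F_tangle V E k (F2 V E k) Or) \<longleftrightarrow>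
            \<not> (\<exists>N TE \<alpha>. is_Sk_tree V E k (F2 V E k) N TE \<alpha>))
       \<and> (\<not> (\<exists>N TE \<alpha>. is_Sk_tree V E k (F2 V E k) N TE \<alpha>) \<longleftrightarrow> pathwidth V E \<ge> k - 1)"
proof -
  interpret graph_order V E k by unfold_locales (rule assms)
  \<comment> \<open>The four conditions are joined in a cycle of implications, from (i) through (iv)
    back to (i).\<close>
  have "(\<exists>\<B>. is_blockage V E k \<B>) \<Longrightarrow> (\<exists>Or. is_F_tangle V E k (F2 V E k) Or)"
    using blockage_tangle by blast
  moreover have "(\<exists>Or. is_F_tangle V E k (F2 V E k) Or) \<Longrightarrow>
      \<not> (\<exists>N TE \<alpha>. is_Sk_tree V E k (F2 V E k) N TE \<alpha>)"
    using tangle_no_tree by blast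
  moreover have "\<not> (\<exists>N TE \<alpha>. is_Sk_tree V E k (F2 V E k) N TE \<alpha>) \<Longrightarrow> pathwidth V E \<ge> k - 1"
    using decomp_tree[OF _ _ assms(3)] pathwidth_less_iff[OF assms(2)] not_le by blast
  moreover have "pathwidth V E \<ge> k - 1 \<Longrightarrow> (\<exists>\<B>. is_blockage V E k \<B>)"
    using blockage_exists[OF assms(3)] pathwidth_less_iff[OF assms(2)] not_le by blast
  ultimately show ?thesis by blast
qed

end
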